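(* For every integer $n\ge 2$ there is a smallest integer $m(n)$ such that every $S$-vector on $n$ terminals can be realized in $K_{m(n)}$, and $$m(n)\le M(n),$$ where $M(n)$ is the number of pairwise intersecting antichains of non-empty subsets of $[n]$.
   Context: For a positive integer $k$ let $[k]=\{1,\dots,k\}$. $K_N$ is the undirected complete graph on vertex set $[N]$, with edge set $E_N=\{(i,j):1\le i<j\le N\}$. A weight map is a function $w:E_N\to\mathbb{R}_{\ge 0}$. For $W\subseteq[N]$, the cut $C(W)$ is the set of edges with exactly one endpoint in $W$, and $\|C(W)\|$ is the sum of the weights of its edges. For integers $1\le n<N$, the vertices in $[n]$ of $K_N$ are called terminals, vertex $N$ is the sink. Given $w$ on $K_N$, for each $\varnothing\ne I\subseteq[n]$ set $$S_I=\min\{\|C(W)\| : W\subseteq[N-1],\ W\cap[n]=I\}.$$ The resulting vector $S=(S_I)_{\varnothing\ne I\subseteq[n]}\in\mathbb{R}^{2^n-1}$ is said to be realized by $w$ in $K_N$. An $S$-vector on $n$ terminals is a vector realized by some weight map $w$ in $K_N$ for some $N>n$. A family of subsets of $[n]$ is an antichain if no member is contained in another; it is pairwise intersecting if any two of its members have non-empty intersection. The empty family and families consisting of a single (non-empty) subset are considered pairwise intersecting antichains and are counted in $M(n)$. (Thus $M(1)=2$, $M(2)=4$, $M(3)=12$, $M(4)=81$.) *)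

theory Defs
  imports Complex_Main
begin

definition complete_edges :: "nat \<Rightarrow> (nat \<times> nat) set" where
  "complete_edges N = {(i, j). 1 \<le> i \<and> i < j \<and> j \<le> N}"

text \<open>Only the values of a weight map on the edges matter.\<close>

definition weight_map :: "nat \<Rightarrow> (nat \<times> nat \<Rightarrow> real) \<Rightarrow> bool" where
  "weight_map N w \<longleftrightarrow> (\<forall>e \<in> complete_edges N. 0 \<le> w e)"

definition cut :: "nat \<Rightarrow> nat set \<Rightarrow> (nat \<times> nat) set" where
  "cut N W = {(i, j) \<in> complete_edges N. (i \<in> W) \<noteq> (j \<in> W)}"

definition cut_weight :: "nat \<Rightarrow> (nat \<times> nat \<Rightarrow> real) \<Rightarrow> nat set \<Rightarrow> real" where
  "cut_weight N w W = (\<Sum>e \<in> cut N W. w e)"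

text \<open>The terminals are \<open>1, \<dots>, n\<close> and the sink is \<open>N\<close>. For \<open>n < N\<close> and \<open>I \<subseteq> {1..n}\<close>
  the set below is finite and non-empty, so \<^const>\<open>Min\<close> is a genuine minimum.\<close>

definition min_cut :: "nat \<Rightarrow> nat \<Rightarrow> (nat \<times> nat \<Rightarrow> real) \<Rightarrow> nat set \<Rightarrow> real" where
  "min_cut n N w I = Min {cut_weight N w W | W. W \<subseteq> {1..N - 1} \<and> W \<inter> {1..n} = I}"

text \<open>A vector indexed by the non-empty subsets of \<open>{1..n}\<close> is represented by a function on all
  sets of naturals whose values at other sets are irrelevant.\<close>

definition realized_by :: "nat \<Rightarrow> nat \<Rightarrow> (nat \<times> nat \<Rightarrow> real) \<Rightarrow> (nat set \<Rightarrow> real) \<Rightarrow> bool" where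
  "realized_by n N w S \<longleftrightarrow>
     1 \<le> n \<and> n < N \<and> weight_map N w \<and>
     (\<forall>I. I \<noteq> {} \<and> I \<subseteq> {1..n} \<longrightarrow> S I = min_cut n N w I)"

definition realizable :: "nat \<Rightarrow> nat \<Rightarrow> (nat set \<Rightarrow> real) \<Rightarrow> bool" where
  "realizable n N S \<longleftrightarrow> (\<exists>w. realized_by n N w S)"

definition S_vector :: "nat \<Rightarrow> (nat set \<Rightarrow> real) \<Rightarrow> bool" where
  "S_vector n S \<longleftrightarrow> (\<exists>N > n. realizable n N S)"

definition antichain :: "'a set set \<Rightarrow> bool" where
  "antichain F \<longleftrightarrow> pairwise (\<lambda>A B. \<not> A \<subseteq> B) F"

definition pairwise_intersecting :: "'a set set \<Rightarrow> bool" where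
  "pairwise_intersecting F \<longleftrightarrow> pairwise (\<lambda>A B. A \<inter> B \<noteq> {}) F"

definition num_intersecting_antichains :: "nat \<Rightarrow> nat" where
  "num_intersecting_antichains n =
     card {F. F \<subseteq> Pow {1..n} - {{}} \<and> antichain F \<and> pairwise_intersecting F}"

end

theory Submission imports Defs begin

text \<open>For every non-empty set \<open>I\<close> of terminals take an inclusion-minimal minimum cut \<open>W I\<close>.
  Submodularity of the cut function gives \<open>W I \<subseteq> W J\<close> whenever \<open>I \<subseteq> J\<close>, and its variant for
  differences gives \<open>W I \<inter> W J = {}\<close> whenever \<open>I \<inter> J = {}\<close>. Hence for every vertex \<open>v\<close> the
  family of all \<open>I\<close> with \<open>v \<in> W I\<close> is an intersecting up-set, determined by the antichain of its
  minimal members. Contracting all vertices with the same antichain keeps every \<open>W I\<close> a union of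
  classes, and so preserves all minimum cut values. The terminal \<open>i\<close> has the antichain \<open>{{i}}\<close>
  and the sink has the empty one, so these vertices stay distinct.\<close>

section \<open>Cut weights and two uncrossing inequalities\<close>

lemma finite_complete_edges [simp]: "finite (complete_edges N)"
  by (rule finite_subset[of _ "{1..N} \<times> {1..N}"]) (auto simp: complete_edges_def)

lemma finite_cut [simp]: "finite (cut N W)"
  by (rule finite_subset[of _ "complete_edges N"]) (auto simp: cut_def)

text \<open>With one index set for all cuts, inequalities between cuts can be checked edge by
  edge.\<close>

lemma cut_weight_eq_sum_edges:
  "cut_weight N w W =
     (\<Sum>e \<in> complete_edges N. if (fst e \<in> W) \<noteq> (snd e \<in> W) then w e else 0)"
proof -
  have "cut N W = {e \<in> complete_edges N. (fst e \<in> W) \<noteq> (snd e \<in> W)}"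
    by (auto simp: cut_def)
  then show ?thesis
    unfolding cut_weight_def by (simp add: sum.inter_filter)
qed

text \<open>An edge crossing \<open>A \<inter> B\<close> or \<open>A \<union> B\<close> crosses
  \<open>A\<close> or \<open>B\<close>; if it crosses both of the former, it has one end in
  \<open>A \<inter> B\<close> and the other outside \<open>A \<union> B\<close>, so it crosses both
  \<open>A\<close> and \<open>B\<close>.\<close>

lemma cut_weight_submodular:
  assumes "weight_map N w"
  shows "cut_weight N w (A \<inter> B) + cut_weight N w (A \<union> B) \<le> cut_weight N w A + cut_weight N w B"
  using assms unfolding cut_weight_eq_sum_edges sum.distrib[symmetric] weight_map_def
  by (intro sum_mono) auto

text \<open>This is submodularity with \<open>B\<close> replaced by its complement, since a set and
  its complement are crossed by the same undirected edges.\<close>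

lemma cut_weight_posimodular:
  assumes "weight_map N w"
  shows "cut_weight N w (A - B) + cut_weight N w (B - A) \<le> cut_weight N w A + cut_weight N w B"
  using assms unfolding cut_weight_eq_sum_edges sum.distrib[symmetric] weight_map_def
  by (intro sum_mono) auto

section \<open>Inclusion-minimal minimum cuts\<close>

definition separating :: "nat \<Rightarrow> nat \<Rightarrow> nat set \<Rightarrow> nat set \<Rightarrow> bool" where
  "separating n N I W \<longleftrightarrow> W \<subseteq> {1..N - 1} \<and> W \<inter> {1..n} = I"

definition minimum_cut :: "nat \<Rightarrow> nat \<Rightarrow> (nat \<times> nat \<Rightarrow> real) \<Rightarrow> nat set \<Rightarrow> nat set \<Rightarrow> bool" where
  "minimum_cut n N w I W \<longleftrightarrow>
     separating n N I W \<and> (\<forall>V. separating n N I V \<longrightarrow> cut_weight N w W \<le> cut_weight N w V)"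

definition minimal_minimum_cut ::
    "nat \<Rightarrow> nat \<Rightarrow> (nat \<times> nat \<Rightarrow> real) \<Rightarrow> nat set \<Rightarrow> nat set \<Rightarrow> bool" where
  "minimal_minimum_cut n N w I W \<longleftrightarrow>
     minimum_cut n N w I W \<and> (\<forall>V. minimum_cut n N w I V \<longrightarrow> V \<subseteq> W \<longrightarrow> V = W)"

lemma finite_separating [simp]: "finite {W. separating n N I W}"
  by (rule finite_subset[of _ "Pow {1..N - 1}"]) (auto simp: separating_def)

lemma min_cut_eqI:
  assumes "minimum_cut n N w I W"
  shows "min_cut n N w I = cut_weight N w W"
proof -
  have eq: "{cut_weight N w W | W. W \<subseteq> {1..N - 1} \<and> W \<inter> {1..n} = I}
        = cut_weight N w ` {W. separating n N I W}"
    by (auto simp: separating_def)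
  show ?thesis
    unfolding min_cut_def eq using assms
    by (intro Min_eqI) (auto simp: minimum_cut_def)
qed

lemma ex_minimal_minimum_cut:
  assumes "n < N" "I \<subseteq> {1..n}"
  obtains W where "minimal_minimum_cut n N w I W"
proof -
  have "{1..n} \<subseteq> {1..N - 1}"
    using assms(1) by auto
  then have "separating n N I I"
    using assms(2) unfolding separating_def by blast
  then have "{W. separating n N I W} \<noteq> {}"
    by blast
  from ex_min_if_finite[OF finite_imageI[OF finite_separating], of "cut_weight N w" n N I]
  obtain W where "minimum_cut n N w I W"
    using \<open>{W. separating n N I W} \<noteq> {}\<close>
    by (auto simp: minimum_cut_def not_less)
  moreover have "finite {W. minimum_cut n N w I W}"
    by (rule finite_subset[OF _ finite_separating[of n N I]]) (auto simp: minimum_cut_def)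
  ultimately obtain M where "M \<in> {W. minimum_cut n N w I W}"
      "\<forall>V \<in> {W. minimum_cut n N w I W}. V \<subseteq> M \<longrightarrow> M = V"
    using finite_has_minimal[of "{W. minimum_cut n N w I W}"] by blast
  then show thesis
    using that by (auto simp: minimal_minimum_cut_def)
qed

text \<open>\<open>A \<union> B\<close> competes with \<open>B\<close> for \<open>J\<close>, so
  submodularity makes \<open>A \<inter> B\<close> as cheap as \<open>A\<close>, and minimality of
  \<open>A\<close> forces equality. For \<open>I = J\<close> this shows that the minimal minimum cut
  is unique.\<close>

lemma minimal_minimum_cut_mono:
  assumes w: "weight_map N w" and "I \<subseteq> J"
    and I: "minimal_minimum_cut n N w I A" and J: "minimum_cut n N w J B"
  shows "A \<subseteq> B"
proof -
  have sep: "separating n N I A" "separating n N J B"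
    using I J by (auto simp: minimal_minimum_cut_def minimum_cut_def)
  then have "separating n N J (A \<union> B)" and inter: "separating n N I (A \<inter> B)"
    using \<open>I \<subseteq> J\<close> by (auto simp: separating_def)
  then have "cut_weight N w B \<le> cut_weight N w (A \<union> B)"
    using J by (auto simp: minimum_cut_def)
  then have "cut_weight N w (A \<inter> B) \<le> cut_weight N w A"
    using cut_weight_submodular[OF w, of A B] by linarith
  then have "minimum_cut n N w I (A \<inter> B)"
    using I inter unfolding minimal_minimum_cut_def minimum_cut_def by (meson order_trans)
  then have "A \<inter> B = A"
    using I by (auto simp: minimal_minimum_cut_def)
  then show ?thesis by blast
qed

text \<open>The same exchange with differences: as \<open>I\<close> and \<open>J\<close> are
  disjoint, \<open>A - B\<close> and \<open>B - A\<close> still contain exactly the terminals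
  \<open>I\<close> and \<open>J\<close>.\<close>

lemma minimal_minimum_cut_disjoint:
  assumes w: "weight_map N w" and "I \<inter> J = {}"
    and I: "minimal_minimum_cut n N w I A" and J: "minimum_cut n N w J B"
  shows "A \<inter> B = {}"
proof -
  have sep: "separating n N I A" "separating n N J B"
    using I J by (auto simp: minimal_minimum_cut_def minimum_cut_def)
  then have "separating n N J (B - A)" and diff: "separating n N I (A - B)"
    using \<open>I \<inter> J = {}\<close> by (auto simp: separating_def)
  then have "cut_weight N w B \<le> cut_weight N w (B - A)"
    using J by (auto simp: minimum_cut_def)
  then have "cut_weight N w (A - B) \<le> cut_weight N w A"
    using cut_weight_posimodular[OF w, of A B] by linarith
  then have "minimum_cut n N w I (A - B)"
    using I diff unfolding minimal_minimum_cut_def minimum_cut_def by (meson order_trans)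
  then have "A - B = A"
    using I by (auto simp: minimal_minimum_cut_def)
  then show ?thesis by blast
qed

section \<open>Contraction along a vertex map\<close>

definition contracted_edge :: "(nat \<Rightarrow> nat) \<Rightarrow> nat \<times> nat \<Rightarrow> nat \<times> nat" where
  "contracted_edge f e = (min (f (fst e)) (f (snd e)), max (f (fst e)) (f (snd e)))"

definition contracted_weight ::
    "nat \<Rightarrow> (nat \<Rightarrow> nat) \<Rightarrow> (nat \<times> nat \<Rightarrow> real) \<Rightarrow> nat \<times> nat \<Rightarrow> real" where
  "contracted_weight N f w e' = (\<Sum>e | e \<in> complete_edges N \<and> contracted_edge f e = e'. w e)"

lemma weight_map_contracted:
  "weight_map N w \<Longrightarrow> weight_map M (contracted_weight N f w)"
  by (auto simp: weight_map_def contracted_weight_def intro!: sum_nonneg)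

text \<open>A contracted edge crosses \<open>W\<close> exactly when the original crosses the
  preimage of \<open>W\<close>; the preimage cut is then summed fibre by fibre. Edges at vertices
  outside the range of \<open>f\<close> get an empty sum, hence weight 0.\<close>

lemma cut_weight_contracted:
  assumes f: "\<And>v. v \<in> {1..N} \<Longrightarrow> f v \<in> {1..M}"
  shows "cut_weight M (contracted_weight N f w) W = cut_weight N w {v \<in> {1..N}. f v \<in> W}"
proof -
  let ?V = "{v \<in> {1..N}. f v \<in> W}"
  have img: "contracted_edge f e \<in> cut M W \<longleftrightarrow> e \<in> cut N ?V"
    if edge: "e \<in> complete_edges N" for e
  proof -
    obtain i j where e: "e = (i, j)" by (cases e)
    have ij: "i \<in> {1..N}" "j \<in> {1..N}"
      using edge by (auto simp: e complete_edges_def)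
    then have "(i, j) \<in> cut N ?V \<longleftrightarrow> (f i \<in> W) \<noteq> (f j \<in> W)"
      using edge by (auto simp: e cut_def)
    moreover have "contracted_edge f (i, j) \<in> cut M W \<longleftrightarrow> (f i \<in> W) \<noteq> (f j \<in> W)"
      using f[OF ij(1)] f[OF ij(2)]
      \<comment> \<open>If the images coincide, the result is a loop, which lies in no cut;
        otherwise \<open>min\<close> and \<open>max\<close> restore the order that
        \<open>complete_edges\<close> demands.\<close>
      by (cases "f i" "f j" rule: linorder_cases)
        (auto simp: contracted_edge_def cut_def complete_edges_def min_def max_def)
    ultimately show ?thesis by (simp add: e)
  qed
  have "cut_weight M (contracted_weight N f w) W
      = (\<Sum>e' \<in> cut M W. \<Sum>e | e \<in> cut N ?V \<and> contracted_edge f e = e'. w e)"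
    unfolding cut_weight_def contracted_weight_def
  proof (intro sum.cong refl)
    fix e' assume "e' \<in> cut M W"
    moreover have "cut N ?V \<subseteq> complete_edges N"
      by (auto simp: cut_def)
    ultimately show "{e \<in> complete_edges N. contracted_edge f e = e'}
        = {e \<in> cut N ?V. contracted_edge f e = e'}"
      using img by blast
  qed
  also have "\<dots> = cut_weight N w ?V"
    unfolding cut_weight_def
  proof (rule sum.group)
    have "cut N ?V \<subseteq> complete_edges N"
      by (auto simp: cut_def)
    then show "contracted_edge f ` cut N ?V \<subseteq> cut M W"
      using img by blast
  qed simp_all
  finally show ?thesis .
qed

lemma min_cut_contracted:
  assumes "n < N" "n < M" and I: "I \<subseteq> {1..n}"
    and W: "minimum_cut n N w I W"
    and f: "\<And>v. v \<in> {1..N} \<Longrightarrow> f v \<in> {1..M}"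
    and terminal: "\<And>i. i \<in> {1..n} \<Longrightarrow> f i = i" and sink: "f N = M"
    and saturated: "\<And>u v. u \<in> W \<Longrightarrow> v \<in> {1..N} \<Longrightarrow> f u = f v \<Longrightarrow> v \<in> W"
  shows "min_cut n M (contracted_weight N f w) I = min_cut n N w I"
proof -
  have sep: "W \<subseteq> {1..N - 1}" "W \<inter> {1..n} = I"
    using W by (auto simp: minimum_cut_def separating_def)
  have N: "N \<in> {1..N}" "N \<notin> W"
    using \<open>n < N\<close> sep(1) by auto
  have WN: "W \<subseteq> {1..N}"
    using sep(1) by (rule subset_trans) auto
  have preimage: "{v \<in> {1..N}. f v \<in> f ` W} = W"
  proof
    show "{v \<in> {1..N}. f v \<in> f ` W} \<subseteq> W"
    proof
      fix v assume v: "v \<in> {v \<in> {1..N}. f v \<in> f ` W}"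
      then obtain u where "u \<in> W" "f u = f v" by force
      then show "v \<in> W"
        using saturated[of u v] v by simp
    qed
  qed (use WN in auto)
  have contracted: "cut_weight M (contracted_weight N f w) V = cut_weight N w {v \<in> {1..N}. f v \<in> V}"
    for V using f by (rule cut_weight_contracted)
  have "separating n M I (f ` W)"
    unfolding separating_def
  proof
    \<comment> \<open>A vertex of \<open>W\<close> sent to \<open>M\<close> would share the fibre of
      the old sink and pull \<open>N\<close> into \<open>W\<close>.\<close>
    have "f v \<noteq> M" if "v \<in> W" for v
      using saturated[OF that N(1)] sink N(2) by auto
    then show "f ` W \<subseteq> {1..M - 1}"
      using f WN by fastforce
    have "i \<in> f ` W \<longleftrightarrow> i \<in> W" if "i \<in> {1..n}" for i
    proof -
      have "i \<in> {1..N}" using that \<open>n < N\<close> by auto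
      then show ?thesis
        using preimage terminal[OF that] by force
    qed
    then show "f ` W \<inter> {1..n} = I"
      using sep(2) by blast
  qed
  moreover have "cut_weight N w W \<le> cut_weight N w {v \<in> {1..N}. f v \<in> V}"
    if V: "separating n M I V" for V
  proof -
    have "M \<notin> V"
      using V \<open>n < M\<close> by (auto simp: separating_def)
    then have "{v \<in> {1..N}. f v \<in> V} \<subseteq> {1..N - 1}"
      using sink by (auto simp: le_less)
    moreover have "{v \<in> {1..N}. f v \<in> V} \<inter> {1..n} = V \<inter> {1..n}"
      using terminal \<open>n < N\<close> by auto
    ultimately have "separating n N I {v \<in> {1..N}. f v \<in> V}"
      using V by (simp add: separating_def)
    then show ?thesis
      using W by (auto simp: minimum_cut_def)
  qed
  ultimately have "minimum_cut n M (contracted_weight N f w) I (f ` W)"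
    unfolding minimum_cut_def contracted preimage by blast
  then show ?thesis
    unfolding min_cut_eqI[OF W] contracted[of "f ` W", unfolded preimage, symmetric]
    by (rule min_cut_eqI)
qed

section \<open>Numbering the intersecting antichains\<close>

definition intersecting_antichains :: "nat \<Rightarrow> nat set set set" where
  "intersecting_antichains n =
     {F. F \<subseteq> Pow {1..n} - {{}} \<and> antichain F \<and> pairwise_intersecting F}"

lemma finite_intersecting_antichains: "finite (intersecting_antichains n)"
  by (rule finite_subset[of _ "Pow (Pow {1..n})"]) (auto simp: intersecting_antichains_def)

text \<open>The numbers are the vertex names after contraction, so terminals and sink prescribe the
  values on \<open>T\<close>; the other antichains share the remaining numbers arbitrarily.\<close>

lemma enumeration_of_intersecting_antichains:
  obtains g where "n < num_intersecting_antichains n"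
    "inj_on g (intersecting_antichains n)"
    "g ` intersecting_antichains n \<subseteq> {1..num_intersecting_antichains n}"
    "\<And>i. i \<in> {1..n} \<Longrightarrow> g {{i}} = i" "g {} = num_intersecting_antichains n"
proof -
  let ?A = "intersecting_antichains n"
  let ?M = "num_intersecting_antichains n"
  define T where "T = insert {} ((\<lambda>i. {{i}}) ` {1..n})"
  have M: "card ?A = ?M"
    by (simp add: intersecting_antichains_def num_intersecting_antichains_def)
  have sub: "T \<subseteq> ?A"
    by (auto simp: T_def intersecting_antichains_def antichain_def pairwise_intersecting_def)
  have "card ((\<lambda>i. {{i}}) ` {1..n}) = n"
    by (subst card_image) (auto simp: inj_on_def)
  then have cardT: "card T = Suc n"
    unfolding T_def by (subst card_insert_disjoint) auto
  have "card T \<le> ?M"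
    using card_mono[OF finite_intersecting_antichains sub] M by simp
  then have less: "n < ?M"
    using cardT by simp
  have "finite T" by (simp add: T_def)
  then have "card (?A - T) = card {n + 1..?M - 1}"
    using card_Diff_subset[OF _ sub] M cardT by simp
  then obtain h where h: "bij_betw h (?A - T) {n + 1..?M - 1}"
    using finite_same_card_bij[of "?A - T"] finite_intersecting_antichains by blast
  define g where
    \<comment> \<open>The empty family also lies in \<open>T\<close>, so it is tested first; on
      \<open>{{i}}\<close> the double \<open>the_elem\<close> yields \<open>i\<close>.\<close>
    "g F = (if F = {} then ?M else if F \<in> T then the_elem (the_elem F) else h F)" for F
  have empty: "g {} = ?M" by (simp add: g_def)
  have single: "g {{i}} = i" if "i \<in> {1..n}" for i
    using that by (simp add: g_def T_def)
  have rest: "g F = h F" if "F \<in> ?A - T" for F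
    using that by (auto simp: g_def T_def)
  have "bij_betw g T (insert ?M {1..n})"
    unfolding bij_betw_def
  proof
    show "inj_on g T"
      using less by (auto simp: T_def inj_on_def empty single)
    show "g ` T = insert ?M {1..n}"
      by (simp add: T_def empty image_image single)
  qed
  moreover have "bij_betw g (?A - T) {n + 1..?M - 1}"
    using h bij_betw_cong[of "?A - T" g h, OF rest] by blast
  moreover have "insert ?M {1..n} \<inter> {n + 1..?M - 1} = {}"
    using less by auto
  ultimately have "bij_betw g (T \<union> (?A - T)) (insert ?M {1..n} \<union> {n + 1..?M - 1})"
    by (rule bij_betw_combine)
  then have "bij_betw g ?A (insert ?M {1..n} \<union> {n + 1..?M - 1})"
    using sub by (simp add: Un_absorb1)
  then have "inj_on g ?A" "g ` ?A \<subseteq> {1..?M}"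
    using less by (auto simp: bij_betw_def)
  then show thesis
    using that less single empty by blast
qed

section \<open>Contracting a network onto its antichains\<close>

lemma realizable_num_intersecting_antichains:
  assumes "S_vector n S"
  shows "realizable n (num_intersecting_antichains n) S"
proof -
  let ?M = "num_intersecting_antichains n"
  obtain N w where n: "1 \<le> n" "n < N" and w: "weight_map N w"
    and S: "\<And>I. I \<noteq> {} \<Longrightarrow> I \<subseteq> {1..n} \<Longrightarrow> S I = min_cut n N w I"
    using assms by (auto simp: S_vector_def realizable_def realized_by_def)
  define W where "W I = (SOME A. minimal_minimum_cut n N w I A)" for I
  have W: "minimal_minimum_cut n N w I (W I)" if "I \<subseteq> {1..n}" for I
    unfolding W_def by (rule ex_minimal_minimum_cut[OF n(2) that]) (rule someI)
  then have W': "minimum_cut n N w I (W I)" if "I \<subseteq> {1..n}" for I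
    using that by (auto simp: minimal_minimum_cut_def)
  have sep: "W I \<subseteq> {1..N - 1}" "W I \<inter> {1..n} = I" if "I \<subseteq> {1..n}" for I
    using W'[OF that] by (auto simp: minimum_cut_def separating_def)
  define U where "U v = {I. I \<noteq> {} \<and> I \<subseteq> {1..n} \<and> v \<in> W I}" for v
  define F where "F v = {I \<in> U v. \<forall>J \<in> U v. J \<subseteq> I \<longrightarrow> J = I}" for v
  have F: "F v \<in> intersecting_antichains n" for v
  proof -
    \<comment> \<open>Both \<open>W I\<close> and \<open>W J\<close> contain \<open>v\<close>, so
      disjoint \<open>I\<close> and \<open>J\<close> are impossible.\<close>
    have "I \<inter> J \<noteq> {}" if "I \<in> U v" "J \<in> U v" for I J
      using minimal_minimum_cut_disjoint[OF w _ W W', of I J] that by (auto simp: U_def)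
    then have "pairwise_intersecting (F v)"
      by (auto simp: pairwise_intersecting_def pairwise_def F_def)
    moreover have "antichain (F v)"
      by (auto simp: antichain_def pairwise_def F_def)
    ultimately show ?thesis
      by (auto simp: intersecting_antichains_def F_def U_def)
  qed
  \<comment> \<open>\<open>F v\<close> alone decides whether \<open>v\<close> lies in
    \<open>W I\<close>, so each \<open>W I\<close> is a union of fibres of \<open>F\<close>.
    Finiteness supplies a minimal member below \<open>I\<close>; monotonicity of \<open>W\<close>
    gives the converse.\<close>
  have mem_W: "v \<in> W I \<longleftrightarrow> (\<exists>J \<in> F v. J \<subseteq> I)" if I: "I \<noteq> {}" "I \<subseteq> {1..n}" for v I
  proof
    assume "v \<in> W I"
    have "finite (U v)"
      by (rule finite_subset[of _ "Pow {1..n}"]) (auto simp: U_def)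
    moreover have "I \<in> U v"
      using I \<open>v \<in> W I\<close> by (simp add: U_def)
    ultimately obtain J where "J \<in> U v" "J \<subseteq> I" "\<forall>K \<in> U v. K \<subseteq> J \<longrightarrow> J = K"
      using finite_has_minimal2[of "U v" I] by blast
    then show "\<exists>J \<in> F v. J \<subseteq> I"
      by (auto simp: F_def)
  next
    assume "\<exists>J \<in> F v. J \<subseteq> I"
    then obtain J where "J \<in> U v" "J \<subseteq> I"
      by (auto simp: F_def)
    then show "v \<in> W I"
      using minimal_minimum_cut_mono[OF w \<open>J \<subseteq> I\<close> W W'] I by (auto simp: U_def)
  qed
  \<comment> \<open>\<open>W I\<close> contains exactly the terminals in \<open>I\<close>, so
    \<open>U i\<close> has the least member \<open>{i}\<close>.\<close>
  have F_terminal: "F i = {{i}}" if i: "i \<in> {1..n}" for i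
  proof -
    have U: "I \<in> U i \<longleftrightarrow> i \<in> I \<and> I \<subseteq> {1..n}" for I
      using sep(2)[of I] i unfolding U_def by blast
    have "{i} \<in> U i"
      using i by (simp add: U)
    then show ?thesis
      by (auto simp: F_def U)
  qed
  have "N \<notin> {1..N - 1}"
    using n by auto
  then have F_sink: "F N = {}"
    using sep(1) unfolding F_def U_def by blast
  obtain g where g: "n < ?M" "inj_on g (intersecting_antichains n)"
      "g ` intersecting_antichains n \<subseteq> {1..?M}"
      "\<And>i. i \<in> {1..n} \<Longrightarrow> g {{i}} = i" "g {} = ?M"
    using enumeration_of_intersecting_antichains[of n] by blast
  define f where "f v = g (F v)" for v
  have f_eq: "F u = F v" if "f u = f v" for u v
    using inj_onD[OF g(2)] that F by (simp add: f_def)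
  have "S I = min_cut n ?M (contracted_weight N f w) I" if I: "I \<noteq> {}" "I \<subseteq> {1..n}" for I
  proof -
    have "min_cut n ?M (contracted_weight N f w) I = min_cut n N w I"
    proof (rule min_cut_contracted[OF n(2) g(1) I(2) W'[OF I(2)]])
      show "f v \<in> {1..?M}" for v
        using g(3) F unfolding f_def by blast
      show "f i = i" if "i \<in> {1..n}" for i
        using that by (simp add: f_def F_terminal g(4))
      show "f N = ?M"
        by (simp add: f_def F_sink g(5))
      show "v \<in> W I" if "u \<in> W I" "f u = f v" for u v
        using that f_eq[OF that(2)] by (simp add: mem_W[OF I])
    qed
    then show ?thesis
      using S[OF I] by simp
  qed
  then have "realized_by n ?M (contracted_weight N f w) S"
    using n(1) g(1) weight_map_contracted[OF w] by (auto simp: realized_by_def)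
  then show ?thesis
    by (auto simp: realizable_def)
qed

theorem corollary1:
  fixes n :: nat
  assumes "n \<ge> 2"
  shows "\<exists>m. (\<forall>S. S_vector n S \<longrightarrow> realizable n m S) \<and>
             (\<forall>k. (\<forall>S. S_vector n S \<longrightarrow> realizable n k S) \<longrightarrow> m \<le> k) \<and>
             m \<le> num_intersecting_antichains n"
proof -
  let ?P = "\<lambda>m. \<forall>S. S_vector n S \<longrightarrow> realizable n m S"
  have P: "?P (num_intersecting_antichains n)"
    using realizable_num_intersecting_antichains by blast
  show ?thesis
    \<comment> \<open>\<open>Least_le\<close> gives both minimality and, applied to the number of
      antichains, the upper bound.\<close>
    by (rule exI[of _ "LEAST m. ?P m"])
      (use LeastI[of ?P, OF P] Least_le[of ?P] P in blast)
qed

end
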